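(* Let $\langle A,\rightarrow,\top\rangle$ be a BCI-algebra with induced order $\preceq$, and let $\mathbb{A}=\{[a,b]: a,b\in A,\ a\preceq b\}$. If there are $a,b\in A$ with $a\neq b$ and $a\rightarrow b=\top$, then for every interval $D\in\mathbb{A}$ there is no interval representation $F$ of $\rightarrow$ such that $\langle \mathbb{A},F,D\rangle$ is a BCI-algebra.
   Context: A BCI-algebra is a structure $\langle B,\rightarrow,\top\rangle$, with $\rightarrow$ a binary operation on $B$ and $\top\in B$, such that for all $x,y,z\in B$: (C1) $(y\rightarrow z)\rightarrow((z\rightarrow x)\rightarrow(y\rightarrow x))=\top$; (C2) $x\rightarrow((x\rightarrow y)\rightarrow y)=\top$; (C3) $x\rightarrow x=\top$; (C4) if $x\rightarrow y=\top$ and $y\rightarrow x=\top$ then $x=y$. Its induced relation is $x\preceq y$ iff $x\rightarrow y=\top$ (a partial order). For $X=[a,b]\in\mathbb{A}$ write $\underline{X}=a$, $\overline{X}=b$, and say $x\in X$ if $\underline X\preceq x\preceq\overline X$. A binary operation $F:\mathbb{A}\times\mathbb{A}\to\mathbb{A}$ is an interval representation of $\rightarrow$ if for all $X,Y\in\mathbb{A}$ and all $x\in X$, $y\in Y$ one has $x\rightarrow y\in F(X,Y)$. *)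

theory Defs
  imports Main
begin

locale bci_algebra =
  fixes B :: "'a set"
    and imp :: "'a \<Rightarrow> 'a \<Rightarrow> 'a"  (infixr \<open>\<rightarrow>\<close> 65)
    and tp :: 'a  (\<open>\<top>\<close>)
  assumes imp_closed: "\<lbrakk>x \<in> B; y \<in> B\<rbrakk> \<Longrightarrow> x \<rightarrow> y \<in> B"
    and top_closed: "\<top> \<in> B"
    and C1: "\<lbrakk>x \<in> B; y \<in> B; z \<in> B\<rbrakk>
      \<Longrightarrow> (y \<rightarrow> z) \<rightarrow> ((z \<rightarrow> x) \<rightarrow> (y \<rightarrow> x)) = \<top>"
    and C2: "\<lbrakk>x \<in> B; y \<in> B\<rbrakk> \<Longrightarrow> x \<rightarrow> ((x \<rightarrow> y) \<rightarrow> y) = \<top>"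
    and C3: "x \<in> B \<Longrightarrow> x \<rightarrow> x = \<top>"
    and C4: "\<lbrakk>x \<in> B; y \<in> B; x \<rightarrow> y = \<top>; y \<rightarrow> x = \<top>\<rbrakk> \<Longrightarrow> x = y"

definition bci_le :: "('a \<Rightarrow> 'a \<Rightarrow> 'a) \<Rightarrow> 'a \<Rightarrow> 'a \<Rightarrow> 'a \<Rightarrow> bool" where
  "bci_le imp tp x y \<longleftrightarrow> imp x y = tp"

text \<open>
  The interval \<open>[a, b]\<close> is encoded by its pair of endpoints \<open>(a, b)\<close>. As the induced
  relation of a BCI-algebra is a partial order, a nonempty interval determines its endpoints,
  so this identifies the same intervals as the encoding by sets of elements.
\<close>

definition intervals :: "'a set \<Rightarrow> ('a \<Rightarrow> 'a \<Rightarrow> 'a) \<Rightarrow> 'a \<Rightarrow> ('a \<times> 'a) set" where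
  "intervals A imp tp = {(a, b) | a b. a \<in> A \<and> b \<in> A \<and> bci_le imp tp a b}"

definition in_interval ::
  "'a set \<Rightarrow> ('a \<Rightarrow> 'a \<Rightarrow> 'a) \<Rightarrow> 'a \<Rightarrow> 'a \<Rightarrow> 'a \<times> 'a \<Rightarrow> bool" where
  "in_interval A imp tp x X \<longleftrightarrow>
     x \<in> A \<and> bci_le imp tp (fst X) x \<and> bci_le imp tp x (snd X)"

definition interval_representation ::
  "'a set \<Rightarrow> ('a \<Rightarrow> 'a \<Rightarrow> 'a) \<Rightarrow> 'a \<Rightarrow> ('a \<times> 'a \<Rightarrow> 'a \<times> 'a \<Rightarrow> 'a \<times> 'a) \<Rightarrow> bool" where
  "interval_representation A imp tp F \<longleftrightarrow>
     (\<forall>X \<in> intervals A imp tp. \<forall>Y \<in> intervals A imp tp.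
        F X Y \<in> intervals A imp tp \<and>
        (\<forall>x y. in_interval A imp tp x X \<longrightarrow> in_interval A imp tp y Y \<longrightarrow>
           in_interval A imp tp (imp x y) (F X Y)))"

end

theory Submission
  imports Defs
begin

text \<open>
  If \<open>\<langle>\<bbbA>, F, D\<rangle>\<close> is a BCI-algebra, then \<open>F X X = D\<close>
  for every \<open>X\<close>. With \<open>a \<prec> b\<close> and \<open>X = [a, b]\<close> this puts \<open>c = b \<rightarrow> a\<close> in \<open>D\<close>. As
  \<open>F D [c, c] = [c, c]\<close>, the element \<open>c \<rightarrow> c = \<top>\<close> lies in \<open>[c, c]\<close>, so \<open>b \<rightarrow> a = \<top>\<close> and
  \<open>a = b\<close>.
\<close>

context bci_algebra
begin

text \<open>Maximality of \<open>\<top>\<close>: C2 with both variables equal to \<open>u\<close>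
  collapses to \<open>u \<rightarrow> \<top> = \<top>\<close>, and antisymmetry finishes.\<close>

lemma top_le_imp_eq_top:
  assumes u: "u \<in> B" and le: "\<top> \<rightarrow> u = \<top>"
  shows "u = \<top>"
proof -
  have "u \<rightarrow> ((u \<rightarrow> u) \<rightarrow> u) = \<top>"
    using u by (rule C2[OF _ u])
  then have "u \<rightarrow> \<top> = \<top>"
    by (simp add: C3[OF u] le)
  then show ?thesis
    using C4[OF u top_closed] le by simp
qed

lemma top_imp:
  assumes x: "x \<in> B"
  shows "\<top> \<rightarrow> x = x"
proof (rule C4)
  show tx: "\<top> \<rightarrow> x \<in> B"
    using top_closed x by (rule imp_closed)
  \<comment> \<open>C2 places this element above \<open>\<top>\<close>, which is maximal.\<close>
  show "(\<top> \<rightarrow> x) \<rightarrow> x = \<top>"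
    by (rule top_le_imp_eq_top[OF imp_closed[OF tx x] C2[OF top_closed x]])
  show "x \<rightarrow> (\<top> \<rightarrow> x) = \<top>"
    using C2[OF x x] by (simp add: C3[OF x])
qed (rule x)

end

theorem theorem1:
  fixes A :: "'a set" and imp :: "'a \<Rightarrow> 'a \<Rightarrow> 'a" and tp :: 'a
  assumes "bci_algebra A imp tp"
    and "\<exists>a\<in>A. \<exists>b\<in>A. a \<noteq> b \<and> imp a b = tp"
  shows "\<forall>D \<in> intervals A imp tp.
    \<not> (\<exists>F. interval_representation A imp tp F \<and>
            bci_algebra (intervals A imp tp) F D)"
proof (intro ballI notI, elim exE conjE)
  fix D F
  assume D: "D \<in> intervals A imp tp"
    and rep: "interval_representation A imp tp F"
    and "bci_algebra (intervals A imp tp) F D"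
  then interpret I: bci_algebra "intervals A imp tp" F D by simp
  interpret A: bci_algebra A imp tp by (rule assms(1))
  have mem: "in_interval A imp tp (imp x y) (F X Y)"
    if "X \<in> intervals A imp tp" "Y \<in> intervals A imp tp"
      "in_interval A imp tp x X" "in_interval A imp tp y Y" for x y X Y
    using rep that unfolding interval_representation_def by blast
  obtain a b where ab: "a \<in> A" "b \<in> A" "a \<noteq> b" "imp a b = tp"
    using assms(2) by blast
  define c where "c = imp b a"
  have c: "c \<in> A"
    unfolding c_def using ab by (intro A.imp_closed)
  have X: "(a, b) \<in> intervals A imp tp"
    using ab by (simp add: intervals_def bci_le_def)
  \<comment> \<open>Both endpoints belong to \<open>[a, b]\<close>, so they may be taken in reverse
    order.\<close>
  have "in_interval A imp tp c (F (a, b) (a, b))"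
    unfolding c_def using ab A.C3
    by (intro mem X) (simp_all add: in_interval_def bci_le_def)
  then have cD: "in_interval A imp tp c D"
    by (simp add: I.C3[OF X])
  have C: "(c, c) \<in> intervals A imp tp"
    using c A.C3 by (simp add: intervals_def bci_le_def)
  have "in_interval A imp tp (imp c c) (F D (c, c))"
    using c A.C3 by (intro mem D C cD) (simp add: in_interval_def bci_le_def)
  then have "in_interval A imp tp tp (c, c)"
    by (simp add: I.top_imp[OF C] A.C3[OF c])
  \<comment> \<open>The upper endpoint of \<open>[c, c]\<close> puts \<open>tp\<close> below
    \<open>c\<close>; maximality of \<open>tp\<close> in \<open>A\<close> applies.\<close>
  then have "c = tp"
    using A.top_le_imp_eq_top[OF c] by (simp add: in_interval_def bci_le_def)
  then show False
    using ab A.C4[of a b] by (simp add: c_def)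
qed

end
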